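(* Let $G=(V,E,\vartheta,w)$ be a connected, locally finite, stochastically complete weighted graph equipped with the fractional Laplace operator $\Delta^{\epsilon}$, $\epsilon\in(0,1)$. For any positive function $u:V\to\mathbb{R}^+$ and any variable exponent $m:V\times[0,\infty)\to\mathbb{R}^+$, the following identity holds at each vertex $x\in V$: $$\Delta^{\epsilon}(u^{m(x,t)})=2u^{\frac{m(x,t)}{2}}\Delta^{\epsilon}(u^{\frac{m(x,t)}{2}})+2\Gamma^{\epsilon}(u^{\frac{m(x,t)}{2}}).$$
   Context: $G=(V,E,\vartheta,w)$ is a graph with vertex set $V$, edge set $E$, vertex measure $\vartheta:V\to(0,\infty)$ and symmetric edge weights $w_{xy}=w_{yx}>0$ if $x\sim y$ (adjacent), $w_{xy}=0$ otherwise. Locally finite: every vertex has finitely many neighbors. Let $p_t(x,y)$ be the heat kernel of $G$ (associated with $\Delta f(x)=\frac{1}{\vartheta(x)}\sum_{y\sim x}w_{xy}(f(y)-f(x))$). $G$ is stochastically complete if $\sum_{y\in V}p_t(x,y)\vartheta(y)=1$ for all $t>0$, $x\in V$. For $\epsilon\in(0,1)$ and $x\ne y$, $W_{\epsilon}(x,y)=\frac{\epsilon}{\Gamma(1-\epsilon)}\vartheta(x)\vartheta(y)\int_0^{\infty}p_t(x,y)t^{-1-\epsilon}\,dt$, where $\Gamma(1-\epsilon)$ is the Gamma function. For $f:V\to\mathbb{R}$, $$\Delta^{\epsilon}f(x)=\frac{1}{\vartheta(x)}\sum_{y\in V,\,y\ne x}W_{\epsilon}(x,y)(f(y)-f(x)),\qquad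 \Gamma^{\epsilon}(f)(x)=\frac{1}{2\vartheta(x)}\sum_{y\in V,\,y\ne x}W_{\epsilon}(x,y)(f(y)-f(x))^2.$$ Notation: for fixed $t\ge0$, $u^{m(x,t)}$ denotes the function $x\mapsto u(x)^{m(x,t)}$ on $V$, and $u^{m(x,t)/2}$ denotes $x\mapsto u(x)^{m(x,t)/2}$ (the exponent is evaluated at the same vertex as $u$). *)

theory Defs
  imports "HOL-Analysis.Analysis"
begin

text \<open>
  Weighted graphs \<open>G = (V, E, \<vartheta>, w)\<close>. The edge set is a symmetric relation on the vertices.
  Loops are not excluded; they contribute nothing to any of the operators below.
  The values of the vertex measure and of the weights outside the vertex set are irrelevant.
\<close>

record 'a wgraph =
  verts :: "'a set"
  edges :: "('a \<times> 'a) set"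
  meas :: "'a \<Rightarrow> real"
  weight :: "'a \<Rightarrow> 'a \<Rightarrow> real"

definition weighted_graph :: "'a wgraph \<Rightarrow> bool" where
  "weighted_graph G \<longleftrightarrow>
     edges G \<subseteq> verts G \<times> verts G \<and> sym (edges G) \<and>
     (\<forall>x\<in>verts G. 0 < meas G x) \<and>
     (\<forall>x\<in>verts G. \<forall>y\<in>verts G.
        weight G x y = weight G y x \<and>
        ((x, y) \<in> edges G \<longrightarrow> 0 < weight G x y) \<and>
        ((x, y) \<notin> edges G \<longrightarrow> weight G x y = 0))"

definition locally_finite_graph :: "'a wgraph \<Rightarrow> bool" where
  "locally_finite_graph G \<longleftrightarrow> (\<forall>x\<in>verts G. finite (edges G `` {x}))"

definition connected_graph :: "'a wgraph \<Rightarrow> bool" where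
  "connected_graph G \<longleftrightarrow> (\<forall>x\<in>verts G. \<forall>y\<in>verts G. (x, y) \<in> (edges G)\<^sup>*)"

definition graph_laplacian :: "'a wgraph \<Rightarrow> ('a \<Rightarrow> real) \<Rightarrow> 'a \<Rightarrow> real" where
  "graph_laplacian G f x =
     1 / meas G x * (\<Sum>y\<in>edges G `` {x}. weight G x y * (f y - f x))"

text \<open>
  A nonnegative fundamental solution solves the heat equation in its first space variable, with
  initial value the unit mass \<open>\<delta>\<^sub>y / \<vartheta>(y)\<close>. The heat kernel is the smallest one. (On an infinite
  graph this is the increasing limit of the Dirichlet heat kernels along an exhaustion by finite
  subsets; minimality determines \<open>p t x y\<close> for all \<open>t > 0\<close> and all vertices \<open>x\<close>, \<open>y\<close>.)
\<close>

definition fundamental_solution :: "'a wgraph \<Rightarrow> (real \<Rightarrow> 'a \<Rightarrow> 'a \<Rightarrow> real) \<Rightarrow> bool" where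
  "fundamental_solution G p \<longleftrightarrow>
     (\<forall>x\<in>verts G. \<forall>y\<in>verts G.
        (\<forall>t>0. 0 \<le> p t x y) \<and>
        (\<forall>t>0. ((\<lambda>s. p s x y) has_real_derivative
                  graph_laplacian G (\<lambda>z. p t z y) x) (at t)) \<and>
        ((\<lambda>t. p t x y) \<longlongrightarrow> (if x = y then 1 / meas G y else 0)) (at_right 0))"

definition is_heat_kernel :: "'a wgraph \<Rightarrow> (real \<Rightarrow> 'a \<Rightarrow> 'a \<Rightarrow> real) \<Rightarrow> bool" where
  "is_heat_kernel G p \<longleftrightarrow>
     fundamental_solution G p \<and>
     (\<forall>q. fundamental_solution G q \<longrightarrow>
        (\<forall>t>0. \<forall>x\<in>verts G. \<forall>y\<in>verts G. p t x y \<le> q t x y))"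

definition stochastically_complete ::
    "'a wgraph \<Rightarrow> (real \<Rightarrow> 'a \<Rightarrow> 'a \<Rightarrow> real) \<Rightarrow> bool" where
  "stochastically_complete G p \<longleftrightarrow>
     (\<forall>t>0. \<forall>x\<in>verts G. ((\<lambda>y. p t x y * meas G y) has_sum 1) (verts G))"

definition frac_weight ::
    "'a wgraph \<Rightarrow> (real \<Rightarrow> 'a \<Rightarrow> 'a \<Rightarrow> real) \<Rightarrow> real \<Rightarrow> 'a \<Rightarrow> 'a \<Rightarrow> real" where
  "frac_weight G p \<epsilon> x y =
     \<epsilon> / Gamma (1 - \<epsilon>) * meas G x * meas G y *
       (LINT t:{0<..}|lborel. p t x y * t powr (- 1 - \<epsilon>))"

text \<open>
  For a function that is unbounded on an infinite graph the series below may diverge to \<open>\<infinity>\<close>.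
  They are therefore unordered sums in the extended reals: \<open>infsum\<close> at type \<open>ereal\<close> is the limit
  of the finite partial sums, and it takes the value \<open>\<infinity>\<close> when these tend to \<open>\<infinity>\<close>. This is the case
  whenever the negative parts are summable and the positive parts are not. If a series converges
  absolutely, its value is that of the real series; see
  \<open>frac_laplacian_eq_real\<close> and \<open>frac_gradient_form_eq_real\<close>.
\<close>

definition frac_laplacian ::
    "'a wgraph \<Rightarrow> (real \<Rightarrow> 'a \<Rightarrow> 'a \<Rightarrow> real) \<Rightarrow> real \<Rightarrow> ('a \<Rightarrow> real) \<Rightarrow> 'a \<Rightarrow> ereal" where
  "frac_laplacian G p \<epsilon> f x =
     ereal (1 / meas G x) *
       (\<Sum>\<^sub>\<infinity>y\<in>verts G - {x}. ereal (frac_weight G p \<epsilon> x y * (f y - f x)))"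

definition frac_gradient_form ::
    "'a wgraph \<Rightarrow> (real \<Rightarrow> 'a \<Rightarrow> 'a \<Rightarrow> real) \<Rightarrow> real \<Rightarrow> ('a \<Rightarrow> real) \<Rightarrow> 'a \<Rightarrow> ereal" where
  "frac_gradient_form G p \<epsilon> f x =
     ereal (1 / (2 * meas G x)) *
       (\<Sum>\<^sub>\<infinity>y\<in>verts G - {x}. ereal (frac_weight G p \<epsilon> x y * (f y - f x)\<^sup>2))"

lemma infsum_ereal_eq:
  fixes g :: "'a \<Rightarrow> real"
  assumes "g summable_on A"
  shows "(\<Sum>\<^sub>\<infinity>y\<in>A. ereal (g y)) = ereal (\<Sum>\<^sub>\<infinity>y\<in>A. g y)"
proof -
  have "(sum g \<longlongrightarrow> infsum g A) (finite_subsets_at_top A)"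
    using assms has_sum_infsum unfolding has_sum_def by blast
  then have "((\<lambda>F. ereal (sum g F)) \<longlongrightarrow> ereal (infsum g A)) (finite_subsets_at_top A)"
    by (intro tendsto_intros)
  then have "((\<lambda>y. ereal (g y)) has_sum ereal (infsum g A)) A"
    unfolding has_sum_def by (subst (asm) sum_ereal[symmetric])
  then show ?thesis
    by (rule infsumI)
qed

lemma frac_laplacian_eq_real:
  assumes "(\<lambda>y. frac_weight G p \<epsilon> x y * (f y - f x)) summable_on (verts G - {x})"
  shows "frac_laplacian G p \<epsilon> f x =
    ereal (1 / meas G x * (\<Sum>\<^sub>\<infinity>y\<in>verts G - {x}. frac_weight G p \<epsilon> x y * (f y - f x)))"
  using infsum_ereal_eq[OF assms] by (simp add: frac_laplacian_def)

lemma frac_gradient_form_eq_real: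
  assumes "(\<lambda>y. frac_weight G p \<epsilon> x y * (f y - f x)\<^sup>2) summable_on (verts G - {x})"
  shows "frac_gradient_form G p \<epsilon> f x =
    ereal (1 / (2 * meas G x) *
      (\<Sum>\<^sub>\<infinity>y\<in>verts G - {x}. frac_weight G p \<epsilon> x y * (f y - f x)\<^sup>2))"
  using infsum_ereal_eq[OF assms] by (simp add: frac_gradient_form_def)

end

theory Submission
  imports Defs
begin

text \<open>
  Put \<open>v = u\<^bsup>m/2\<^esup>\<close>, so that \<open>u\<^bsup>m\<^esup> = v\<^sup>2\<close>. The identity is the sum over \<open>y\<close>,
  against the weights \<open>W\<^sub>\<epsilon>(x,y)\<close>, of
  \<open>v(y)\<^sup>2 - v(x)\<^sup>2 = 2 v(x) (v(y) - v(x)) + (v(y) - v(x))\<^sup>2\<close>.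
  As \<open>v\<close> may be unbounded, the sums are extended reals, and splitting the left-hand sum is legitimate
  only if \<open>\<infinity> - \<infinity>\<close> cannot occur. The quadratic part is nonnegative; the linear part satisfies
  \<open>W\<^sub>\<epsilon>(x,y) (v(y) - v(x)) \<ge> - W\<^sub>\<epsilon>(x,y) v(x)\<close> because \<open>v \<ge> 0\<close>. So everything rests on
  \<open>\<Sum>\<^sub>y\<^sub>\<noteq>\<^sub>x W\<^sub>\<epsilon>(x,y) < \<infinity>\<close> (lemma \<open>frac_weight_summable\<close>): the linear sum then exists and is not \<open>-\<infinity>\<close>
  (lemma \<open>has_sum_ereal_bounded_below\<close>).

  Stochastic completeness gives \<open>\<Sum>\<^sub>y\<^sub>\<noteq>\<^sub>x p\<^sub>t(x,y) \<vartheta>(y) \<le> 1 - p\<^sub>t(x,x) \<vartheta>(x)\<close>. The heat equation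
  at the diagonal gives \<open>\<partial>\<^sub>t p\<^sub>t(x,x) \<ge> - D p\<^sub>t(x,x)\<close>, where \<open>D\<close> is the total edge weight at \<open>x\<close>
  divided by \<open>\<vartheta>(x)\<close>, hence
  \<open>p\<^sub>t(x,x) \<vartheta>(x) \<ge> exp (- D t)\<close> (lemma \<open>diagonal_lower_bound\<close>). The mass off the diagonal is
  therefore at most \<open>min 1 (D t)\<close>, and this is integrable against \<open>t\<^bsup>-1-\<epsilon>\<^esup>\<close> on \<open>(0,\<infinity>)\<close>: the linear
  bound is used near \<open>0\<close> since \<open>\<epsilon> < 1\<close>, the constant bound near \<open>\<infinity>\<close> since \<open>\<epsilon> > 0\<close>.
\<close>

section \<open>Unordered sums of extended reals\<close>

lemma has_sum_ereal_real:
  fixes g :: "'a \<Rightarrow> real"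
  assumes "g summable_on A"
  shows "((\<lambda>y. ereal (g y)) has_sum ereal (infsum g A)) A"
  using tendsto_ereal[OF has_sum_infsum[OF assms, unfolded has_sum_def]]
  by (simp add: has_sum_def flip: sum_ereal)

text \<open>
  Addition of extended reals is not jointly continuous, so \<open>has_sum_add\<close> does not apply; it is
  continuous at \<open>(S, T)\<close> unless these are \<open>\<infinity>\<close> and \<open>-\<infinity>\<close> in some order.
\<close>

lemma has_sum_add_ereal:
  fixes f g :: "'a \<Rightarrow> ereal"
  assumes "(f has_sum S) A" "(g has_sum T) A" "S \<noteq> -\<infinity>" "T \<noteq> -\<infinity>"
  shows "((\<lambda>y. f y + g y) has_sum (S + T)) A"
  using assms unfolding has_sum_def sum.distrib
  by (intro tendsto_add_ereal_general) auto

lemma has_sum_cmult_ereal: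
  fixes g :: "'a \<Rightarrow> real"
  assumes "((\<lambda>y. ereal (g y)) has_sum S) A"
  shows "((\<lambda>y. ereal (c * g y)) has_sum (ereal c * S)) A"
proof -
  have "((\<lambda>F. ereal c * (\<Sum>y\<in>F. ereal (g y))) \<longlongrightarrow> ereal c * S) (finite_subsets_at_top A)"
    using assms unfolding has_sum_def by (intro tendsto_cmult_ereal) (auto simp del: sum_ereal)
  moreover have "sum (\<lambda>y. ereal (c * g y)) = (\<lambda>F. ereal c * (\<Sum>y\<in>F. ereal (g y)))"
    by (rule ext) (simp add: sum_distrib_left)
  ultimately show ?thesis
    unfolding has_sum_def by simp
qed

text \<open>
  Adding the summable bound \<open>h\<close> makes all terms nonnegative, where an extended real sum always
  exists; subtracting the finite sum of \<open>h\<close> again cannot produce \<open>-\<infinity>\<close>.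
\<close>

lemma has_sum_ereal_bounded_below:
  fixes g h :: "'a \<Rightarrow> real"
  assumes "h summable_on A" and "\<And>y. y \<in> A \<Longrightarrow> - h y \<le> g y"
  obtains S where "((\<lambda>y. ereal (g y)) has_sum S) A" "S \<noteq> -\<infinity>"
proof -
  define P where "P = (\<Sum>\<^sub>\<infinity>y\<in>A. ereal (g y + h y))"
  have nonneg: "0 \<le> ereal (g y + h y)" if "y \<in> A" for y
    using assms(2)[OF that] by simp
  have P: "((\<lambda>y. ereal (g y + h y)) has_sum P) A"
    unfolding P_def by (intro has_sum_infsum nonneg_summable_on_complete nonneg)
  have "0 \<le> P"
    unfolding P_def by (intro infsum_nonneg nonneg)
  then have ne: "P \<noteq> -\<infinity>" by auto
  have H: "((\<lambda>y. ereal (- h y)) has_sum ereal (\<Sum>\<^sub>\<infinity>y\<in>A. - h y)) A"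
    using assms(1) by (intro has_sum_ereal_real) (simp add: summable_on_uminus)
  have "((\<lambda>y. ereal (g y)) has_sum (P + ereal (\<Sum>\<^sub>\<infinity>y\<in>A. - h y))) A"
    using has_sum_add_ereal[OF P H ne] by simp
  moreover have "P + ereal (\<Sum>\<^sub>\<infinity>y\<in>A. - h y) \<noteq> -\<infinity>"
    using ne by (cases P) auto
  ultimately show ?thesis using that by blast
qed

section \<open>Heat kernel bounds\<close>

lemma weighted_graph_neighbour:
  assumes "weighted_graph G" "z \<in> edges G `` {x}"
  shows "z \<in> verts G" "0 \<le> weight G x z"
proof -
  have "x \<in> verts G" "z \<in> verts G" "(x, z) \<in> edges G"
    using assms unfolding weighted_graph_def by auto
  then show "z \<in> verts G" "0 \<le> weight G x z"
    using assms(1) unfolding weighted_graph_def by (auto intro: less_imp_le)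
qed

lemma fundamental_solution_nonneg:
  assumes "fundamental_solution G p" "x \<in> verts G" "y \<in> verts G" "0 < t"
  shows "0 \<le> p t x y"
  using assms unfolding fundamental_solution_def by blast

lemma fundamental_solution_continuous_on:
  assumes "fundamental_solution G p" "x \<in> verts G" "y \<in> verts G"
  shows "continuous_on {0<..} (\<lambda>t. p t x y)"
proof (rule continuous_at_imp_continuous_on, rule ballI)
  fix t :: real assume "t \<in> {0<..}"
  then have "((\<lambda>s. p s x y) has_real_derivative graph_laplacian G (\<lambda>z. p t z y) x) (at t)"
    using assms unfolding fundamental_solution_def by auto
  then show "isCont (\<lambda>t. p t x y) t" by (rule DERIV_isCont)
qed

text \<open>
  In the heat equation the incoming heat \<open>w\<^sub>x\<^sub>z p\<^sub>t(z,x)\<close> is nonnegative, so \<open>p\<^sub>t(x,x)\<close> decays at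
  most at the rate \<open>D\<close> at which heat leaves \<open>x\<close>: the function \<open>exp (D t) p\<^sub>t(x,x)\<close> increases from
  its initial value \<open>1 / \<vartheta>(x)\<close>.
\<close>

lemma diagonal_lower_bound:
  assumes G: "weighted_graph G" and p: "fundamental_solution G p" and x: "x \<in> verts G"
    and t: "0 < t"
  defines "D \<equiv> 1 / meas G x * (\<Sum>z\<in>edges G `` {x}. weight G x z)"
  shows "exp (- (D * t)) \<le> p t x x * meas G x"
proof -
  let ?N = "edges G `` {x}"
  have meas: "0 < meas G x"
    using G x unfolding weighted_graph_def by blast
  note N = weighted_graph_neighbour[OF G]
  have lap: "- (D * p s x x) \<le> graph_laplacian G (\<lambda>z. p s z x) x" if s: "0 < s" for s
  proof -
    have "(\<Sum>z\<in>?N. weight G x z * (- p s x x)) \<le> (\<Sum>z\<in>?N. weight G x z * (p s z x - p s x x))"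
      using fundamental_solution_nonneg[OF p _ x s] N by (intro sum_mono mult_left_mono) auto
    then have "1 / meas G x * (\<Sum>z\<in>?N. weight G x z * (- p s x x)) \<le> graph_laplacian G (\<lambda>z. p s z x) x"
      unfolding graph_laplacian_def using meas by (intro mult_left_mono) auto
    then show ?thesis
      unfolding D_def by (simp add: sum_distrib_right[symmetric] sum_negf)
  qed
  define F where "F = (\<lambda>s. exp (D * s) * p s x x)"
  have mono: "F a \<le> F b" if "0 < a" "a \<le> b" for a b
  proof (rule DERIV_nonneg_imp_nondecreasing[OF \<open>a \<le> b\<close>])
    fix s assume "a \<le> s" "s \<le> b"
    then have s: "0 < s" using \<open>0 < a\<close> by simp
    let ?L = "graph_laplacian G (\<lambda>z. p s z x) x"
    have "((\<lambda>r. p r x x) has_real_derivative ?L) (at s)"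
      using p x s unfolding fundamental_solution_def by blast
    then have "(F has_real_derivative exp (D * s) * (D * p s x x + ?L)) (at s)"
      unfolding F_def by (auto intro!: derivative_eq_intros simp: algebra_simps)
    moreover have "0 \<le> exp (D * s) * (D * p s x x + ?L)"
      using lap[OF s] by simp
    ultimately show "\<exists>y. (F has_real_derivative y) (at s) \<and> 0 \<le> y" by blast
  qed
  have "((\<lambda>s. p s x x) \<longlongrightarrow> 1 / meas G x) (at_right 0)"
    using p x unfolding fundamental_solution_def by (metis (full_types))
  then have "(F \<longlongrightarrow> exp (D * 0) * (1 / meas G x)) (at_right 0)"
    unfolding F_def by (intro tendsto_intros)
  moreover have "eventually (\<lambda>s. F s \<le> F t) (at_right 0)"
    using t by (intro eventually_at_rightI[of 0 t] mono) auto
  ultimately have "exp (D * 0) * (1 / meas G x) \<le> F t"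
    by (intro tendsto_upperbound) auto
  then show ?thesis
    using meas unfolding F_def by (simp add: exp_minus field_simps)
qed

lemma off_diagonal_mass_bound:
  assumes G: "weighted_graph G" and p: "fundamental_solution G p"
    and sc: "stochastically_complete G p" and x: "x \<in> verts G"
  obtains D where "0 \<le> D"
    and "\<And>t F. \<lbrakk>0 < t; finite F; F \<subseteq> verts G - {x}\<rbrakk>
           \<Longrightarrow> (\<Sum>y\<in>F. p t x y * meas G y) \<le> min 1 (D * t)"
proof
  let ?D = "1 / meas G x * (\<Sum>z\<in>edges G `` {x}. weight G x z)"
  have meas: "0 < meas G y" if "y \<in> verts G" for y
    using G that unfolding weighted_graph_def by blast
  have "0 \<le> (\<Sum>z\<in>edges G `` {x}. weight G x z)"
    by (intro sum_nonneg weighted_graph_neighbour[OF G])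
  then show "0 \<le> ?D" using meas[OF x] by simp
  fix t :: real and F assume t: "0 < t" and F: "finite F" "F \<subseteq> verts G - {x}"
  have nonneg: "0 \<le> p t x y * meas G y" if "y \<in> verts G" for y
    using fundamental_solution_nonneg[OF p x that t] meas[OF that] by simp
  have "((\<lambda>y. p t x y * meas G y) has_sum 1) (verts G)"
    using sc t x unfolding stochastically_complete_def by blast
  then have "(\<Sum>y\<in>insert x F. p t x y * meas G y) \<le> 1"
    by (rule finite_sum_le_has_sum) (use F x nonneg in auto)
  moreover have "x \<notin> F" using F by auto
  ultimately have sum: "p t x x * meas G x + (\<Sum>y\<in>F. p t x y * meas G y) \<le> 1"
    using F by simp
  have "1 - ?D * t \<le> exp (- (?D * t))"
    using exp_ge_add_one_self[of "- (?D * t)"] by simp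
  also have "\<dots> \<le> p t x x * meas G x"
    by (rule diagonal_lower_bound[OF G p x t])
  finally show "(\<Sum>y\<in>F. p t x y * meas G y) \<le> min 1 (?D * t)"
    using sum nonneg[OF x] by linarith
qed

section \<open>Summability of the fractional weights\<close>

lemma set_integrable_min_linear_powr:
  fixes D \<epsilon> :: real
  assumes "0 \<le> D" "0 < \<epsilon>" "\<epsilon> < 1"
  shows "set_integrable lborel {0<..} (\<lambda>t. min 1 (D * t) * t powr (- 1 - \<epsilon>))"
proof -
  have powr_lborel: "set_integrable lborel A (\<lambda>t. t powr a)"
    if "(\<lambda>t. t powr a) integrable_on A" "A \<in> sets borel" for a :: real and A :: "real set"
  proof -
    have "(\<lambda>t. t powr a) absolutely_integrable_on A"
      using that by (intro nonnegative_absolutely_integrable_1) auto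
    then show ?thesis
      unfolding set_integrable_def using that(2) by (subst (asm) integrable_completion) auto
  qed
  have meas: "set_borel_measurable lborel A (\<lambda>t. min 1 (D * t) * t powr (- 1 - \<epsilon>))"
    if "A \<in> sets borel" for A
    unfolding set_borel_measurable_def using that by measurable
  have near: "set_integrable lborel {0<..1} (\<lambda>t. D * t powr (- \<epsilon>))"
    using assms by (intro set_integrable_mult_right powr_lborel integrable_on_powr_from_0') auto
  have "set_integrable lborel {0<..1} (\<lambda>t. min 1 (D * t) * t powr (- 1 - \<epsilon>))"
  proof (rule set_integrable_bound[OF near meas]; (rule AE_I2)?)
    fix t :: real
    show "t \<in> {0<..1} \<longrightarrow>
        norm (min 1 (D * t) * t powr (- 1 - \<epsilon>)) \<le> norm (D * t powr (- \<epsilon>))"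
    proof
      assume t: "t \<in> {0<..1}"
      have "min 1 (D * t) * t powr (- 1 - \<epsilon>) \<le> D * t * t powr (- 1 - \<epsilon>)"
        by (intro mult_right_mono) auto
      also have "t powr (- \<epsilon>) = t powr (1 + (- 1 - \<epsilon>))" by simp
      then have "D * t * t powr (- 1 - \<epsilon>) = D * t powr (- \<epsilon>)"
        using t by (simp only: powr_add) simp
      finally show "norm (min 1 (D * t) * t powr (- 1 - \<epsilon>)) \<le> norm (D * t powr (- \<epsilon>))"
        using t assms by (simp add: abs_mult)
    qed
  qed auto
  moreover have far: "set_integrable lborel {1..} (\<lambda>t. t powr (- 1 - \<epsilon>))"
    using has_integral_powr_to_inf[of "- 1 - \<epsilon>" 1] assms
    by (intro powr_lborel) (auto simp: integrable_on_def)
  have "set_integrable lborel {1..} (\<lambda>t. min 1 (D * t) * t powr (- 1 - \<epsilon>))"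
    using assms
    by (intro set_integrable_bound[OF far meas] AE_I2) (auto simp: abs_mult intro!: mult_left_le_one_le)
  ultimately have "set_integrable lborel ({0<..1} \<union> {1..}) (\<lambda>t. min 1 (D * t) * t powr (- 1 - \<epsilon>))"
    by (rule set_integrable_Un) auto
  moreover have "{0<..1} \<union> {1..} = {0::real<..}" by auto
  ultimately show ?thesis by simp
qed

lemma frac_weight_nonneg:
  assumes "weighted_graph G" "fundamental_solution G p" "0 < \<epsilon>" "\<epsilon> < 1"
    and "x \<in> verts G" "y \<in> verts G"
  shows "0 \<le> frac_weight G p \<epsilon> x y"
proof -
  have "0 < meas G x" "0 < meas G y"
    using assms unfolding weighted_graph_def by blast+
  moreover have "0 \<le> (LINT t:{0<..}|lborel. p t x y * t powr (- 1 - \<epsilon>))"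
    unfolding set_lebesgue_integral_def using fundamental_solution_nonneg[OF assms(2,5,6)]
    by (intro integral_nonneg_AE AE_I2) (auto simp: indicator_def)
  ultimately show ?thesis
    unfolding frac_weight_def using assms(3,4)
    by (intro mult_nonneg_nonneg divide_nonneg_nonneg)
       (auto intro!: less_imp_le[OF Gamma_real_pos])
qed

text \<open>
  Up to a constant factor, every finite partial sum is the integral of a partial off-diagonal mass
  against \<open>t\<^bsup>-1-\<epsilon>\<^esup>\<close>, so the integral of \<open>min 1 (D t) t\<^bsup>-1-\<epsilon>\<^esup>\<close> bounds all of them at once.
\<close>

lemma frac_weight_summable:
  assumes G: "weighted_graph G" and p: "fundamental_solution G p"
    and sc: "stochastically_complete G p" and \<epsilon>: "0 < \<epsilon>" "\<epsilon> < 1" and x: "x \<in> verts G"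
  shows "frac_weight G p \<epsilon> x summable_on (verts G - {x})"
proof -
  obtain D where D: "0 \<le> D" and bound: "\<And>t F. \<lbrakk>0 < t; finite F; F \<subseteq> verts G - {x}\<rbrakk>
           \<Longrightarrow> (\<Sum>y\<in>F. p t x y * meas G y) \<le> min 1 (D * t)"
    using off_diagonal_mass_bound[OF G p sc x] by blast
  let ?A = "verts G - {x}"
  let ?g = "\<lambda>t. min 1 (D * t) * t powr (- 1 - \<epsilon>)"
  let ?k = "\<lambda>y t. p t x y * meas G y * t powr (- 1 - \<epsilon>)"
  let ?c = "\<epsilon> / Gamma (1 - \<epsilon>) * meas G x"
  have meas: "0 < meas G y" if "y \<in> verts G" for y
    using G that unfolding weighted_graph_def by blast
  have c: "0 \<le> ?c"
    using \<epsilon> meas[OF x] by (auto intro!: mult_nonneg_nonneg less_imp_le[OF Gamma_real_pos])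
  have g: "set_integrable lborel {0<..} ?g"
    by (rule set_integrable_min_linear_powr[OF D \<epsilon>])
  have k: "set_integrable lborel {0<..} (?k y)" if y: "y \<in> ?A" for y
  proof (rule set_integrable_bound[OF g]; (rule AE_I2)?)
    have "continuous_on {0<..} (?k y)"
      using y x by (intro continuous_intros fundamental_solution_continuous_on[OF p]) auto
    then show "set_borel_measurable lborel {0<..} (?k y)"
      unfolding set_borel_measurable_def
      using borel_measurable_continuous_on_indicator[of "{0<..}" "?k y"] by simp
    fix t :: real
    show "t \<in> {0<..} \<longrightarrow> norm (?k y t) \<le> norm (?g t)"
    proof
      assume t: "t \<in> {0<..}"
      have "0 \<le> p t x y * meas G y"
        using fundamental_solution_nonneg[OF p x, of y t] meas[of y] y t by auto
      moreover have "p t x y * meas G y \<le> min 1 (D * t)"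
        using bound[of t "{y}"] y t by simp
      ultimately show "norm (?k y t) \<le> norm (?g t)"
        unfolding real_norm_def abs_mult[of _ "t powr _"]
        by (intro mult_right_mono) linarith+
    qed
  qed
  have weight: "frac_weight G p \<epsilon> x y = ?c * (LINT t:{0<..}|lborel. ?k y t)" for y
  proof -
    have "(LINT t:{0<..}|lborel. ?k y t)
        = (LINT t:{0<..}|lborel. meas G y * (p t x y * t powr (- 1 - \<epsilon>)))"
      by (simp add: mult_ac)
    then show ?thesis unfolding frac_weight_def by simp
  qed
  have partial: "sum (frac_weight G p \<epsilon> x) F \<le> ?c * (LINT t:{0<..}|lborel. ?g t)"
    if F: "F \<subseteq> ?A" "finite F" for F
  proof -
    have int: "set_integrable lborel {0<..} (\<lambda>t. \<Sum>y\<in>F. ?k y t)"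
      using k F unfolding set_integrable_def scaleR_sum_right
      by (intro Bochner_Integration.integrable_sum) auto
    have "(\<Sum>y\<in>F. LINT t:{0<..}|lborel. ?k y t) = (LINT t:{0<..}|lborel. \<Sum>y\<in>F. ?k y t)"
      using k F unfolding set_lebesgue_integral_def set_integrable_def scaleR_sum_right
      by (intro Bochner_Integration.integral_sum[symmetric]) auto
    also have "\<dots> \<le> (LINT t:{0<..}|lborel. ?g t)"
    proof (rule set_integral_mono[OF int g])
      fix t :: real assume "t \<in> {0<..}"
      then show "(\<Sum>y\<in>F. ?k y t) \<le> ?g t"
        unfolding sum_distrib_right[symmetric] using bound F
        by (intro mult_right_mono) auto
    qed
    finally show ?thesis
      unfolding weight sum_distrib_left[symmetric] using c by (intro mult_left_mono)
  qed
  then have "bdd_above (sum (frac_weight G p \<epsilon> x) ` {F. F \<subseteq> ?A \<and> finite F})"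
    by (auto intro!: bdd_aboveI)
  then show ?thesis
    using frac_weight_nonneg[OF G p \<epsilon> x]
    by (intro nonneg_bdd_above_summable_on) auto
qed

section \<open>The square of a nonnegative function\<close>

text \<open>
  Nonnegativity of \<open>v\<close> enters twice: it keeps the negative part of the linear sum finite, and it
  keeps the factor \<open>2 v(x)\<close> from turning a linear sum \<open>\<infinity>\<close> into \<open>-\<infinity>\<close>.
\<close>

lemma frac_laplacian_square:
  assumes G: "weighted_graph G" and p: "fundamental_solution G p"
    and sc: "stochastically_complete G p" and \<epsilon>: "0 < \<epsilon>" "\<epsilon> < 1" and x: "x \<in> verts G"
    and v: "\<And>z. z \<in> verts G \<Longrightarrow> 0 \<le> v z"
  shows "frac_laplacian G p \<epsilon> (\<lambda>z. (v z)\<^sup>2) x =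
    2 * ereal (v x) * frac_laplacian G p \<epsilon> v x + 2 * frac_gradient_form G p \<epsilon> v x"
proof -
  let ?A = "verts G - {x}"
  let ?W = "frac_weight G p \<epsilon> x"
  have W: "0 \<le> ?W y" if "y \<in> ?A" for y
    using frac_weight_nonneg[OF G p \<epsilon> x] that by simp
  have "(\<lambda>y. ?W y * v x) summable_on ?A"
    by (intro summable_on_cmult_left frac_weight_summable[OF G p sc \<epsilon> x])
  moreover have "- (?W y * v x) \<le> ?W y * (v y - v x)" if "y \<in> ?A" for y
    using mult_left_mono[OF _ W[OF that], of "- v x" "v y - v x"] v[of y] that by simp
  ultimately obtain L
    where L: "((\<lambda>y. ereal (?W y * (v y - v x))) has_sum L) ?A" and L_ne: "L \<noteq> -\<infinity>"
    by (rule has_sum_ereal_bounded_below)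
  define Q where "Q = (\<Sum>\<^sub>\<infinity>y\<in>?A. ereal (?W y * (v y - v x)\<^sup>2))"
  have Q: "((\<lambda>y. ereal (?W y * (v y - v x)\<^sup>2)) has_sum Q) ?A"
    unfolding Q_def using W by (intro has_sum_infsum nonneg_summable_on_complete) simp
  have Q_nonneg: "0 \<le> Q"
    unfolding Q_def using W by (intro infsum_nonneg) simp
  have "ereal (2 * v x) * L \<noteq> -\<infinity>" "Q \<noteq> -\<infinity>"
    using L_ne Q_nonneg v[OF x] by (cases L; auto)+
  then have "((\<lambda>y. ereal (2 * v x * (?W y * (v y - v x))) + ereal (?W y * (v y - v x)\<^sup>2))
      has_sum (ereal (2 * v x) * L + Q)) ?A"
    by (intro has_sum_add_ereal has_sum_cmult_ereal L Q)
  moreover have "2 * v x * (?W y * (v y - v x)) + ?W y * (v y - v x)\<^sup>2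
      = ?W y * ((v y)\<^sup>2 - (v x)\<^sup>2)" for y
    by (simp add: power2_eq_square algebra_simps)
  ultimately have sq: "(\<Sum>\<^sub>\<infinity>y\<in>?A. ereal (?W y * ((v y)\<^sup>2 - (v x)\<^sup>2))) = ereal (2 * v x) * L + Q"
    by (intro infsumI) simp
  have "0 < meas G x"
    using G x unfolding weighted_graph_def by blast
  moreover have "(2::ereal) = ereal 2" by simp
  \<comment> \<open>The case \<open>v x = 0\<close> is separate because then \<open>L = \<infinity>\<close> contributes \<open>0 * \<infinity> = 0\<close>.\<close>
  ultimately show ?thesis
    unfolding frac_laplacian_def frac_gradient_form_def sq infsumI[OF L] Q_def[symmetric]
    using L_ne Q_nonneg v[OF x]
    by (cases L; cases Q; cases "v x = 0") (auto simp: field_simps)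
qed

theorem lemma3p1:
  fixes G :: "'a wgraph"
    and p :: "real \<Rightarrow> 'a \<Rightarrow> 'a \<Rightarrow> real"
    and \<epsilon> :: real
    and u :: "'a \<Rightarrow> real"
    and m :: "'a \<Rightarrow> real \<Rightarrow> real"
    and t :: real
    and x :: 'a
  assumes "weighted_graph G"
    and "connected_graph G"
    and "locally_finite_graph G"
    and "is_heat_kernel G p"
    and "stochastically_complete G p"
    and "0 < \<epsilon>" and "\<epsilon> < 1"
    and "\<And>z. z \<in> verts G \<Longrightarrow> 0 < u z"
    and "\<And>z s. z \<in> verts G \<Longrightarrow> 0 \<le> s \<Longrightarrow> 0 < m z s"
    and "0 \<le> t"
    and "x \<in> verts G"
  shows "frac_laplacian G p \<epsilon> (\<lambda>z. u z powr m z t) x =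
           2 * ereal (u x powr (m x t / 2)) * frac_laplacian G p \<epsilon> (\<lambda>z. u z powr (m z t / 2)) x
           + 2 * frac_gradient_form G p \<epsilon> (\<lambda>z. u z powr (m z t / 2)) x"
proof -
  have p: "fundamental_solution G p"
    using assms(4) unfolding is_heat_kernel_def by blast
  let ?v = "\<lambda>z. u z powr (m z t / 2)"
  have square: "u z powr m z t = (?v z)\<^sup>2" for z
    by (simp add: power2_eq_square flip: powr_add)
  show ?thesis
    unfolding square
    by (rule frac_laplacian_square[OF assms(1) p assms(5-7,11)]) simp
qed

end
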